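(* Let $Q^t = \{x \in \mathbb{R}^n : \hat{A}^t x \ge \hat{b}^t\}$ be a nonempty polyhedron given by $\hat{q}_t$ linear inequality constraints. Let $N^t \subseteq \{1,\dots,\hat{q}_t\}$ be the set of indices of $n$ linearly independent constraints of $Q^t$, so that $\hat{A}^t_{N^t}$ is an invertible $n \times n$ matrix, and let $C^t = \{x \in \mathbb{R}^n : \hat{A}^t_{N^t} x \ge \hat{b}^t_{N^t}\}$ be the associated basis cone. Let $\bar{\alpha} \in \mathbb{R}^n$ and $\bar{\beta} \in \mathbb{R}$. If the inequality $\bar{\alpha}^{\mathsf T} x \ge \bar{\beta}$ is valid for $C^t$ (that is, satisfied by every $x \in C^t$), then the Farkas certificate $v^t \in \mathbb{R}^{1 \times n}$ for the validity of $\bar{\alpha}^{\mathsf T} x \ge \bar{\beta}$ for $C^t$ is given as follows: the multiplier on constraint $i \in \{1,\dots,n\}$ of $C^t$ has value $v^t_i = \bar{\alpha}^{\mathsf T} r^i$, where $r^i$ is column $i$ of $(\hat{A}^t_{N^t})^{-1}$.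
   Context: For a set of row indices $N$, $\hat{A}^t_N$ and $\hat{b}^t_N$ denote the submatrix of $\hat{A}^t$ and the subvector of $\hat{b}^t$ consisting of the rows indexed by $N$; the constraints of $C^t$ are numbered $1,\dots,n$ in the order of the rows of $\hat{A}^t_{N^t}$. In the source setting, $Q^t$ is one term of a disjunction imposed on the polyhedron $P = \{x \in \mathbb{R}^n_{\ge 0} : Ax \ge b\}$, i.e. $Q^t = \{x \in P : D^t x \ge D^t_0\}$, and $\hat{A}^t x \ge \hat{b}^t$ collects all constraints defining $Q^t$, including nonnegativity. A Farkas certificate for the validity of $\bar{\alpha}^{\mathsf T} x \ge \bar{\beta}$ for a polyhedron $\{x \in \mathbb{R}^n : Mx \ge d\}$, where $M$ has $m$ rows, is a row vector $v \in \mathbb{R}^{1 \times m}$ of multipliers, one per constraint, with $v \ge 0$, $\bar{\alpha}^{\mathsf T} = vM$ and $\bar{\beta} \le vd$. Here it is taken with respect to the $n$ constraints $\hat{A}^t_{N^t} x \ge \hat{b}^t_{N^t}$ of $C^t$. *)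

theory Defs
  imports
    "Jordan_Normal_Form.DL_Submatrix"
    "Jordan_Normal_Form.DL_Rank"
    "Jordan_Normal_Form.Gauss_Jordan_Elimination"
begin

definition polyhedron :: "real mat \<Rightarrow> real vec \<Rightarrow> real vec set" where
  "polyhedron M d = {x \<in> carrier_vec (dim_col M). M *\<^sub>v x \<ge> d}"

(* The analogue of submatrix for vectors: entries are kept in increasing order of their indices. *)
definition subvector :: "'a vec \<Rightarrow> nat set \<Rightarrow> 'a vec" where
  "subvector b N = vec (card {i. i < dim_vec b \<and> i \<in> N}) (\<lambda>i. b $ pick N i)"

definition basis_cone :: "real mat \<Rightarrow> real vec \<Rightarrow> nat set \<Rightarrow> real vec set" where
  "basis_cone A b N = polyhedron (submatrix A N UNIV) (subvector b N)"

(* The rows form an independent family: no two indices in N select the same row vector. *)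
definition lin_indpt_rows :: "real mat \<Rightarrow> nat set \<Rightarrow> bool" where
  "lin_indpt_rows A N \<longleftrightarrow>
     inj_on (row A) N \<and>
     LinearCombinations.module.lin_indpt class_ring (module_vec TYPE(real) (dim_col A)) (row A ` N)"

definition valid_inequality :: "real vec \<Rightarrow> real \<Rightarrow> real vec set \<Rightarrow> bool" where
  "valid_inequality \<alpha> \<beta> S \<longleftrightarrow> (\<forall>x\<in>S. \<alpha> \<bullet> x \<ge> \<beta>)"

(* Row vectors of multipliers have type real vec; mat_of_row turns them into 1-row matrices. *)
definition farkas_certificate ::
    "real mat \<Rightarrow> real vec \<Rightarrow> real vec \<Rightarrow> real \<Rightarrow> real vec \<Rightarrow> bool" where
  "farkas_certificate M d \<alpha> \<beta> v \<longleftrightarrow>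
     v \<in> carrier_vec (dim_row M) \<and>
     v \<ge> 0\<^sub>v (dim_row M) \<and>
     mat_of_row \<alpha> = mat_of_row v * M \<and>
     \<beta> \<le> v \<bullet> d"

end

theory Submission
  imports Defs
begin

text \<open>
  Write M for the basis matrix, d for its right-hand side and R for the inverse of M. Since
  \<open>\<alpha> = v M\<close> forces \<open>v = \<alpha> R\<close>, only the signs of \<open>w = \<alpha> R\<close> and the bound \<open>\<beta> \<le> w d\<close> are at issue.
  The substitution \<open>x = R y\<close> turns the cone into the orthant \<open>y \<ge> d\<close> and \<open>\<alpha> x\<close> into \<open>w y\<close>. At
  \<open>y = d\<close> validity gives \<open>\<beta> \<le> w d\<close>, and a negative entry of w would make \<open>w y\<close> unbounded below
  on the orthant.
\<close>

lemma submatrix_rows_carrier: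
  assumes "A \<in> carrier_mat q n" "N \<subseteq> {..<q}"
  shows "submatrix A N UNIV \<in> carrier_mat (card N) n"
proof -
  have "{i. i < q \<and> i \<in> N} = N" using assms(2) by auto
  then show ?thesis using assms(1) by (intro carrier_matI) (auto simp: dim_submatrix)
qed

lemma subvector_carrier:
  assumes "b \<in> carrier_vec q" "N \<subseteq> {..<q}"
  shows "subvector b N \<in> carrier_vec (card N)"
proof -
  have "{i. i < q \<and> i \<in> N} = N" using assms(2) by auto
  then show ?thesis using assms(1) by (simp add: subvector_def)
qed

text \<open>\<open>pick I\<close> is strictly increasing below \<open>card I\<close>, hence
  injective there. An injective map into a finite set of the same cardinality is onto.\<close>

lemma bij_betw_pick:
  assumes "finite I"
  shows "bij_betw (pick I) {..<card I} I"
proof -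
  have "inj_on (pick I) {..<card I}"
    by (rule linorder_inj_onI) (auto dest: pick_mono_le)
  moreover have "pick I ` {..<card I} \<subseteq> I" by (auto intro: pick_in_set_le)
  ultimately show ?thesis
    unfolding bij_betw_def using assms
    by (metis card_image card_lessThan card_subset_eq)
qed

lemma row_submatrix_rows:
  assumes "A \<in> carrier_mat q n" "N \<subseteq> {..<q}" "i < card N"
  shows "row (submatrix A N UNIV) i = row A (pick N i)"
proof -
  have N: "{i. i < q \<and> i \<in> N} = N" using assms(2) by auto
  have "pick N i < q" using assms(2,3) pick_in_set_le[of i N] by auto
  then show ?thesis using assms(1,3) N
    by (intro eq_vecI) (auto simp: dim_submatrix submatrix_index pick_UNIV)
qed

text \<open>Full rank is available for matrices whose columns are distinct and form an independent
  set, so the argument runs on the transpose. Distinctness must be tracked separately, since passing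
  to the set of rows forgets repetitions; it comes from injectivity of \<open>row A\<close> on
  \<open>N\<close> and of \<open>pick N\<close>.\<close>

lemma det_submatrix_lin_indpt_rows:
  assumes A: "A \<in> carrier_mat q n" and N: "N \<subseteq> {..<q}" "card N = n"
    and indpt: "lin_indpt_rows A N"
  shows "det (submatrix A N UNIV) \<noteq> 0"
proof -
  interpret vec_space "TYPE(real)" n .
  let ?M = "submatrix A N UNIV"
  have M: "?M \<in> carrier_mat n n" using submatrix_rows_carrier[OF A N(1)] N(2) by simp
  have "finite N" using N(1) finite_subset by blast
  then have pick: "bij_betw (pick N) {..<n} N" using bij_betw_pick N(2) by blast
  have cols: "cols ?M\<^sup>T = map (row A \<circ> pick N) [0..<n]"
    using M row_submatrix_rows[OF A N(1)] N(2) by (auto simp: rows_def)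
  have "inj_on (row A \<circ> pick N) {..<n}"
    using indpt pick by (auto simp: lin_indpt_rows_def bij_betw_def intro: comp_inj_on)
  then have "distinct (cols ?M\<^sup>T)"
    unfolding cols by (simp add: distinct_map atLeast0LessThan)
  moreover have "set (cols ?M\<^sup>T) = row A ` N"
    unfolding cols using bij_betw_imp_surj_on[OF pick]
    by (metis atLeast0LessThan image_comp set_map set_upt)
  then have "lin_indpt (set (cols ?M\<^sup>T))"
    using indpt A by (simp add: lin_indpt_rows_def)
  ultimately have "rank ?M\<^sup>T = n"
    using M by (intro lin_indpt_full_rank) auto
  then show ?thesis
    using M det_rank_iff[of "?M\<^sup>T"] by (simp add: det_transpose[OF M])
qed

lemma mat_inverse_det_nonzero:
  fixes M :: "'a :: field mat"
  assumes M: "M \<in> carrier_mat n n" and "det M \<noteq> 0"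
  obtains R where "mat_inverse M = Some R" "R \<in> carrier_mat n n"
    "M * R = 1\<^sub>m n" "R * M = 1\<^sub>m n"
proof -
  have "M \<in> Units (ring_mat TYPE('a) n n)" using assms by (rule det_non_zero_imp_unit)
  then obtain R where "mat_inverse M = Some R"
    using mat_inverse(1)[OF M, of n] by (cases "mat_inverse M") auto
  then show ?thesis using that mat_inverse(2)[OF M] by blast
qed

text \<open>This is associativity, (v A) B = v (A B), with both row-vector products spelled out
  entrywise. It serves twice: with \<open>R * M\<close> it shows that \<open>w\<close> represents
  \<alpha>, and with \<open>M * R\<close> it recovers the multipliers from \<alpha>.\<close>

lemma row_vector_mult_right_inverse:
  fixes v :: "'a :: comm_semiring_1 vec"
  assumes v: "v \<in> carrier_vec n" and A: "A \<in> carrier_mat n m" and B: "B \<in> carrier_mat m n"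
    and AB: "A * B = 1\<^sub>m n"
  shows "vec n (\<lambda>j. vec m (\<lambda>i. v \<bullet> col A i) \<bullet> col B j) = v"
proof (rule eq_vecI)
  fix j assume "j < dim_vec v"
  then have j: "j < n" using v by simp
  have "vec m (\<lambda>i. v \<bullet> col A i) \<bullet> col B j = v \<bullet> (A *\<^sub>v col B j)"
    using assoc_scalar_prod[OF v A col_carrier_vec[OF j B]] A by (simp add: mult_mat_vec_def)
  also have "A *\<^sub>v col B j = col (A * B) j" by (rule col_mult2[OF A B j, symmetric])
  also have "v \<bullet> \<dots> = v $ j" using v j by (simp add: AB)
  finally show "vec n (\<lambda>j. vec m (\<lambda>i. v \<bullet> col A i) \<bullet> col B j) $ j = v $ j" using j by simp
qed (use v in simp)

lemma mat_of_row_eq_mult_iff: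
  assumes "v \<in> carrier_vec m" "M \<in> carrier_mat m n"
  shows "mat_of_row \<alpha> = mat_of_row v * M \<longleftrightarrow> \<alpha> = vec n (\<lambda>j. v \<bullet> col M j)"
proof -
  have "mat_of_row v * M = mat_of_row (vec n (\<lambda>j. v \<bullet> col M j))"
    using assms by (intro eq_matI) auto
  \<comment> \<open>\<open>mat_of_row\<close> is injective, because row 0 gives the vector
    back.\<close>
  then show ?thesis by (metis row_mat_of_row)
qed

text \<open>Moving from \<open>d\<close> along the unit vector \<open>i\<close> stays in the orthant
  and changes the product with \<open>v\<close> at rate \<open>v $ i\<close>, so a negative entry
  eventually breaks the bound.\<close>

lemma nonneg_if_bounded_below_on_orthant:
  fixes v d :: "'a :: linordered_field vec"
  assumes v: "v \<in> carrier_vec n" and d: "d \<in> carrier_vec n"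
    and bound: "\<And>y. y \<in> carrier_vec n \<Longrightarrow> y \<ge> d \<Longrightarrow> v \<bullet> y \<ge> \<beta>"
  shows "v \<ge> 0\<^sub>v n"
proof -
  have "0 \<le> v $ i" if i: "i < n" for i
  proof (rule ccontr)
    assume "\<not> 0 \<le> v $ i"
    then have neg: "v $ i < 0" by simp
    \<comment> \<open>This step length makes the product exactly \<beta> - 1. It is nonnegative
      because the bound at \<open>d\<close> itself makes the numerator negative.\<close>
    define t where "t = (\<beta> - v \<bullet> d - 1) / v $ i"
    have "v \<bullet> d \<ge> \<beta>" using bound d by blast
    then have "t \<ge> 0" unfolding t_def using neg by (intro divide_nonpos_neg) auto
    then have "\<beta> \<le> v \<bullet> (d + t \<cdot>\<^sub>v unit_vec n i)"
      using d by (intro bound) (auto simp: less_eq_vec_def unit_vec_def)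
    also have "\<dots> = v \<bullet> d + t * v $ i"
      using v d i by (simp add: scalar_prod_add_distrib[of _ n])
    also have "\<dots> = \<beta> - 1" using neg by (simp add: t_def)
    finally show False by simp
  qed
  then show ?thesis using v by (simp add: less_eq_vec_def)
qed

theorem lemma3:
  fixes A :: "real mat" and b :: "real vec" and N :: "nat set"
    and \<alpha> :: "real vec" and \<beta> :: real and n q :: nat
  assumes A: "A \<in> carrier_mat q n"
    and b: "b \<in> carrier_vec q"
    and nonempty: "polyhedron A b \<noteq> {}"
    and N: "N \<subseteq> {..<q}" "card N = n"
    and indpt: "lin_indpt_rows A N"
    and \<alpha>: "\<alpha> \<in> carrier_vec n"
    and valid: "valid_inequality \<alpha> \<beta> (basis_cone A b N)"
  shows "invertible_mat (submatrix A N UNIV) \<and>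
    (\<exists>R. mat_inverse (submatrix A N UNIV) = Some R \<and>
       (\<forall>v. farkas_certificate (submatrix A N UNIV) (subvector b N) \<alpha> \<beta> v \<longleftrightarrow>
            v = vec n (\<lambda>i. \<alpha> \<bullet> col R i)))"
proof -
  let ?M = "submatrix A N UNIV" and ?d = "subvector b N"
  have M: "?M \<in> carrier_mat n n" using submatrix_rows_carrier[OF A N(1)] N(2) by simp
  have d: "?d \<in> carrier_vec n" using subvector_carrier[OF b N(1)] N(2) by simp
  obtain R where inv: "mat_inverse ?M = Some R" and R: "R \<in> carrier_mat n n"
    and MR: "?M * R = 1\<^sub>m n" and RM: "R * ?M = 1\<^sub>m n"
    using mat_inverse_det_nonzero[OF M det_submatrix_lin_indpt_rows[OF A N indpt]] .
  have invertible: "invertible_mat ?M"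
    using M R MR RM by (auto simp: invertible_mat_def inverts_mat_def)
  define w where "w = vec n (\<lambda>i. \<alpha> \<bullet> col R i)"
  have w: "w \<in> carrier_vec n" by (simp add: w_def)
  have bound: "w \<bullet> y \<ge> \<beta>" if y: "y \<in> carrier_vec n" "y \<ge> ?d" for y
  proof -
    have "?M *\<^sub>v (R *\<^sub>v y) = y"
      using assoc_mult_mat_vec[OF M R y(1)] y(1) by (simp add: MR)
    then have "R *\<^sub>v y \<in> basis_cone A b N"
      using M R y by (simp add: basis_cone_def polyhedron_def)
    then have "\<alpha> \<bullet> (R *\<^sub>v y) \<ge> \<beta>" using valid by (simp add: valid_inequality_def)
    also have "\<alpha> \<bullet> (R *\<^sub>v y) = w \<bullet> y"
      unfolding w_def using assoc_scalar_prod[OF \<alpha> R y(1)] R by (simp add: mult_mat_vec_def)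
    finally show ?thesis .
  qed
  have "farkas_certificate ?M ?d \<alpha> \<beta> w"
    unfolding farkas_certificate_def mat_of_row_eq_mult_iff[OF w M]
    using M w bound[OF d] nonneg_if_bounded_below_on_orthant[OF w d bound]
      row_vector_mult_right_inverse[OF \<alpha> R M RM] by (simp add: w_def)
  \<comment> \<open>Uniqueness comes from the equation \<alpha> = v M alone: multiplying it by
    \<open>R\<close> on the right isolates \<open>v\<close>.\<close>
  moreover have "v = w" if "farkas_certificate ?M ?d \<alpha> \<beta> v" for v
  proof -
    have v: "v \<in> carrier_vec n" and "mat_of_row \<alpha> = mat_of_row v * ?M"
      using that M by (auto simp: farkas_certificate_def)
    then have "\<alpha> = vec n (\<lambda>j. v \<bullet> col ?M j)" by (simp add: mat_of_row_eq_mult_iff[OF v M])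
    then show ?thesis
      using row_vector_mult_right_inverse[OF v M R MR] by (simp add: w_def)
  qed
  ultimately have "farkas_certificate ?M ?d \<alpha> \<beta> v \<longleftrightarrow> v = w" for v by blast
  then show ?thesis unfolding w_def using invertible inv by blast
qed

end
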